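(* Let $h$ be a Legendre function on $\mathbb{R}^n$ and let $f,g:\mathbb{R}^n\to(-\infty,+\infty]$ be proper, closed and convex (possibly nonsmooth). Assume: (a) $\mathrm{im}(\nabla h^* )\subset\mathrm{dom}\,f\cap\mathrm{dom}\,g$; (b) there is $G>0$ such that $\|s\|_\infty\le G$ for every subgradient $s$ of $f$ and every subgradient $s$ of $g$ (at any point); (c) $h$ is $\sigma$-strongly convex over the probability simplex ($\sigma>0$); (d) $\nabla h^*$ is Lipschitz continuous. Then the Bregman Peaceman-Rachford splitting method (BPRS) with $\gamma_k=1/\sqrt{k}$, $k\ge1$, for solving $\min_x f(x)+g(x)$ converges sublinearly; that is, for its iterates $x^{k+1},w^{k+1}$, with $z^{k+1}:=(x^{k+1}+w^{k+1})/2$ and $x^*$ a minimizer of $f+g$, $$\min_{1\le k\le N}\big(f(z^{k+1})+g(z^{k+1})\big)-\big(f(x^* )+g(x^* )\big)\to 0\quad\text{as }N\to\infty,$$ at the sublinear rate $O(\log N/\sqrt N)$.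
   Context: A function $h$ is Legendre if it is proper, lower semicontinuous, strictly convex and essentially smooth; then $\nabla h:\mathrm{int\,dom}\,h\to\mathrm{int\,dom}\,h^*$ is a bijection with inverse $\nabla h^*$. The Bregman distance is $D_h(x,y)=h(x)-h(y)-\langle\nabla h(y),x-y\rangle$. Strong convexity over the probability simplex $\Delta=\{x\ge0,\ \sum_i x_i=1\}$ is with respect to the $\ell_1$ norm: $D_h(x,y)\ge\frac\sigma2\|x-y\|_1^2$ for all $x\in\Delta\cap\mathrm{dom}\,h$, $y\in\Delta\cap\mathrm{int\,dom}\,h$. BPRS for $\min_x f(x)+g(x)$ takes the form (with $\partial f(w^k)$, $\partial g(x^{k+1})$ below standing for any chosen subgradients): from $w^1\in\mathrm{int\,dom}\,h$, for $k\ge1$, $$\bar x^k=\nabla h^*\big(\nabla h(w^k)-\gamma_k\,\partial f(w^k)\big),\qquad x^{k+1}=\operatorname{argmin}_x\ g(x)+\tfrac1{\gamma_k}D_h(x,\bar x^k),$$ $$\bar w^{k+1}=\nabla h^*\big(\nabla h(x^{k+1})-\gamma_k\,\partial g(x^{k+1})\big),\qquad w^{k+1}=\operatorname{argmin}_w\ f(w)+\tfrac1{\gamma_k}D_h(w,\bar w^{k+1}).$$ Standing conventions: the problem $\min_x f(x)+g(x)$ has a minimizer $x^*\in\mathrm{dom}\,h$, and the iterates are well defined and lie in $\mathrm{int\,dom}\,h$. *)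

theory Defs
  imports "HOL-Analysis.Analysis" "HOL-Library.Landau_Symbols"
begin

section \<open>Extended-real-valued convex functions\<close>

definition eff_dom :: "('a \<Rightarrow> ereal) \<Rightarrow> 'a set" where
  "eff_dom f = {x. f x < \<infinity>}"

definition proper :: "('a \<Rightarrow> ereal) \<Rightarrow> bool" where
  "proper f \<longleftrightarrow> (\<forall>x. f x \<noteq> -\<infinity>) \<and> (\<exists>x. f x < \<infinity>)"

text \<open>For a proper function, being closed is the same as being lower semicontinuous.\<close>

definition lsc :: "('a::topological_space \<Rightarrow> ereal) \<Rightarrow> bool" where
  "lsc f \<longleftrightarrow> (\<forall>x. f x \<le> Liminf (at x) f)"

definition econvex :: "('a::real_vector \<Rightarrow> ereal) \<Rightarrow> bool" where
  "econvex f \<longleftrightarrow> (\<forall>x y. \<forall>t\<in>{0<..<1::real}.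
     f ((1 - t) *\<^sub>R x + t *\<^sub>R y) \<le> ereal (1 - t) * f x + ereal t * f y)"

definition strictly_econvex :: "('a::real_vector \<Rightarrow> ereal) \<Rightarrow> bool" where
  "strictly_econvex f \<longleftrightarrow> (\<forall>x\<in>eff_dom f. \<forall>y\<in>eff_dom f. \<forall>t\<in>{0<..<1::real}. x \<noteq> y \<longrightarrow>
     f ((1 - t) *\<^sub>R x + t *\<^sub>R y) < ereal (1 - t) * f x + ereal t * f y)"

definition subdifferential :: "('a::real_inner \<Rightarrow> ereal) \<Rightarrow> 'a \<Rightarrow> 'a set" where
  "subdifferential f x = {s. \<forall>y. f x + ereal (s \<bullet> (y - x)) \<le> f y}"

definition conjugate :: "('a::real_inner \<Rightarrow> ereal) \<Rightarrow> 'a \<Rightarrow> ereal" where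
  "conjugate f u = (SUP x. ereal (u \<bullet> x) - f x)"

text \<open>
  The coercion \<^const>\<open>real_of_ereal\<close> sends infinite values to 0, so these notions are
  meaningful only at interior points of the effective domain of a proper function.
\<close>

definition has_gradient :: "('a::real_inner \<Rightarrow> ereal) \<Rightarrow> 'a \<Rightarrow> 'a \<Rightarrow> bool" where
  "has_gradient f x d \<longleftrightarrow> (GDERIV (\<lambda>y. real_of_ereal (f y)) x :> d)"

definition gradient :: "('a::real_inner \<Rightarrow> ereal) \<Rightarrow> 'a \<Rightarrow> 'a" where
  "gradient f x = (THE d. has_gradient f x d)"


section \<open>Legendre functions and Bregman distances\<close>

definition essentially_smooth :: "('a::real_inner \<Rightarrow> ereal) \<Rightarrow> bool" where
  "essentially_smooth h \<longleftrightarrow>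
     interior (eff_dom h) \<noteq> {} \<and>
     (\<forall>x\<in>interior (eff_dom h). \<exists>d. has_gradient h x d) \<and>
     (\<forall>u l. (\<forall>n::nat. u n \<in> interior (eff_dom h)) \<and> u \<longlonglongrightarrow> l \<and> l \<in> frontier (interior (eff_dom h))
        \<longrightarrow> filterlim (\<lambda>n. norm (gradient h (u n))) at_top sequentially)"

definition legendre :: "('a::real_inner \<Rightarrow> ereal) \<Rightarrow> bool" where
  "legendre h \<longleftrightarrow> proper h \<and> lsc h \<and> strictly_econvex h \<and> essentially_smooth h"

text \<open>Used only for \<^term>\<open>y\<close> in the interior of the effective domain of \<^term>\<open>h\<close>.\<close>

definition bregman :: "('a::real_inner \<Rightarrow> ereal) \<Rightarrow> 'a \<Rightarrow> 'a \<Rightarrow> ereal" where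
  "bregman h x y = h x - h y - ereal (gradient h y \<bullet> (x - y))"

definition prob_simplex :: "(real ^ 'n) set" where
  "prob_simplex = {x. (\<forall>i. 0 \<le> x $ i) \<and> (\<Sum>i\<in>UNIV. x $ i) = 1}"

definition l1_norm :: "real ^ 'n \<Rightarrow> real" where
  "l1_norm x = (\<Sum>i\<in>UNIV. \<bar>x $ i\<bar>)"

definition strongly_convex_on_simplex :: "real \<Rightarrow> (real ^ 'n \<Rightarrow> ereal) \<Rightarrow> bool" where
  "strongly_convex_on_simplex \<sigma> h \<longleftrightarrow>
     (\<forall>x\<in>prob_simplex \<inter> eff_dom h. \<forall>y\<in>prob_simplex \<inter> interior (eff_dom h).
        ereal (\<sigma> / 2 * (l1_norm (x - y))\<^sup>2) \<le> bregman h x y)"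


section \<open>Bregman Peaceman--Rachford splitting\<close>

definition mirror_step :: "('a::real_inner \<Rightarrow> ereal) \<Rightarrow> real \<Rightarrow> 'a \<Rightarrow> 'a \<Rightarrow> 'a \<Rightarrow> bool" where
  "mirror_step h c y s y' \<longleftrightarrow>
     gradient h y - c *\<^sub>R s \<in> interior (eff_dom (conjugate h)) \<and>
     y' = gradient (conjugate h) (gradient h y - c *\<^sub>R s)"

definition bregman_prox :: "('a::real_inner \<Rightarrow> ereal) \<Rightarrow> ('a \<Rightarrow> ereal) \<Rightarrow> real \<Rightarrow> 'a \<Rightarrow> 'a \<Rightarrow> bool" where
  "bregman_prox h \<phi> c y p \<longleftrightarrow>
     is_arg_min (\<lambda>x. \<phi> x + ereal (1 / c) * bregman h x y) (\<lambda>_. True) p"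

text \<open>
  All sequences are indexed from 1 (\<^term>\<open>w\<close>, \<^term>\<open>xbar\<close>) or from 2 (\<^term>\<open>x\<close>,
  \<^term>\<open>wbar\<close>); \<^term>\<open>p k\<close> and \<^term>\<open>q k\<close> are the chosen subgradients.
  The iteration is required to be well defined: every gradient is taken at a point where it
  exists, and every point produced lies in the interior of the effective domain of \<^term>\<open>h\<close>.
\<close>

definition bprs ::
  "('a::real_inner \<Rightarrow> ereal) \<Rightarrow> ('a \<Rightarrow> ereal) \<Rightarrow> ('a \<Rightarrow> ereal) \<Rightarrow> (nat \<Rightarrow> real) \<Rightarrow>
   (nat \<Rightarrow> 'a) \<Rightarrow> (nat \<Rightarrow> 'a) \<Rightarrow> (nat \<Rightarrow> 'a) \<Rightarrow> (nat \<Rightarrow> 'a) \<Rightarrow> (nat \<Rightarrow> 'a) \<Rightarrow> (nat \<Rightarrow> 'a) \<Rightarrow> bool" where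
  "bprs h f g \<gamma> w xbar x wbar p q \<longleftrightarrow>
     w 1 \<in> interior (eff_dom h) \<and>
     (\<forall>k\<ge>1.
        p k \<in> subdifferential f (w k) \<and>
        mirror_step h (\<gamma> k) (w k) (p k) (xbar k) \<and>
        xbar k \<in> interior (eff_dom h) \<and>
        bregman_prox h g (\<gamma> k) (xbar k) (x (k + 1)) \<and>
        x (k + 1) \<in> interior (eff_dom h) \<and>
        q k \<in> subdifferential g (x (k + 1)) \<and>
        mirror_step h (\<gamma> k) (x (k + 1)) (q k) (wbar (k + 1)) \<and>
        wbar (k + 1) \<in> interior (eff_dom h) \<and>
        bregman_prox h f (\<gamma> k) (wbar (k + 1)) (w (k + 1)) \<and>
        w (k + 1) \<in> interior (eff_dom h))"

end

theory Submission
  imports Defs "HOL-Real_Asymp.Real_Asymp"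
begin

text \<open>
  Eliminating the mirror point, each half of an iteration is a move from \<open>a\<close> to \<open>b\<close> with
  \<open>\<nabla>h(b) = \<nabla>h(a) - \<gamma>(s + t)\<close>, where \<open>s \<in> \<partial>f(a)\<close> and \<open>t \<in> \<partial>g(b)\<close> (or with \<open>f\<close> and \<open>g\<close> swapped).
  The Lipschitz continuity of \<open>\<nabla>h*\<close> and the bound on the subgradients give \<open>\<bar>b - a\<bar> = O(\<gamma>)\<close>. The
  three-point identity, in which only \<open>D(b,a) \<ge> 0\<close> is used, and the subgradient inequalities then
  bound \<open>\<gamma>(f(a) + g(b) - f(x*) - g(x*))\<close> by \<open>D(x*,a) - D(x*,b) + O(\<gamma>\<^sup>2)\<close>. As \<open>f\<close> and \<open>g\<close> are Lipschitz on
  the interior of the domain of \<open>h\<close>, replacing \<open>a\<close> and \<open>b\<close> by \<open>z\<close> costs another \<open>O(\<gamma>\<^sup>2)\<close>. The distances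
  telescope, so the minimal gap is at most \<open>(C + C \<Sum>\<gamma>\<^sub>k\<^sup>2) / \<Sum>\<gamma>\<^sub>k\<close>.
\<close>

section \<open>Extended-real-valued convex functions\<close>

lemma proper_finite:
  assumes "proper f" "x \<in> eff_dom f"
  shows "\<exists>r. f x = ereal r"
  using assms by (cases "f x") (auto simp: proper_def eff_dom_def)

lemma subdifferential_imp_eff_dom:
  assumes "proper f" "s \<in> subdifferential f x"
  shows "x \<in> eff_dom f"
proof -
  obtain y where y: "f y < \<infinity>" using assms(1) by (auto simp: proper_def)
  have "f x + ereal (s \<bullet> (y - x)) \<le> f y"
    using assms(2) by (auto simp: subdifferential_def)
  with y have "f x \<noteq> \<infinity>" by force
  then show ?thesis by (auto simp: eff_dom_def)
qed

text \<open>Off \<open>eff_dom h\<close> the right-hand side is infinite and for equal points both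
  sides agree, which leaves exactly the case that the strict inequality covers.\<close>

lemma strictly_econvex_imp_econvex:
  assumes "proper h" "strictly_econvex h"
  shows "econvex h"
  unfolding econvex_def
proof (intro allI ballI)
  fix x y and t :: real
  assume t: "t \<in> {0<..<1}"
  have nm: "h x \<noteq> -\<infinity>" "h y \<noteq> -\<infinity>" using assms(1) by (auto simp: proper_def)
  consider "x \<notin> eff_dom h \<or> y \<notin> eff_dom h" | "x \<in> eff_dom h" "y \<in> eff_dom h" "x \<noteq> y"
    | "x \<in> eff_dom h" "x = y" by blast
  then show "h ((1 - t) *\<^sub>R x + t *\<^sub>R y) \<le> ereal (1 - t) * h x + ereal t * h y"
  proof cases
    case 1
    then have "h x = \<infinity> \<or> h y = \<infinity>" by (auto simp: eff_dom_def)
    with nm t have "ereal (1 - t) * h x + ereal t * h y = \<infinity>"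
      by (cases "h x"; cases "h y") auto
    then show ?thesis by (simp only: ereal_less_eq(1))
  next
    case 2
    then show ?thesis using assms(2) t by (auto simp: strictly_econvex_def intro: less_imp_le)
  next
    case 3
    then obtain r where "h x = ereal r" using proper_finite[OF assms(1)] by blast
    moreover have "(1 - t) *\<^sub>R x + t *\<^sub>R x = x" by (simp add: algebra_simps)
    ultimately show ?thesis using 3 by (simp add: algebra_simps)
  qed
qed

text \<open>\<open>econvex\<close> speaks of the open unit interval; finite values allow the
  endpoints as well, the form that the later arguments along segments use.\<close>

lemma econvex_real:
  assumes "econvex f" "f x = ereal a" "f y = ereal b" "0 \<le> t" "t \<le> 1"
  shows "f ((1 - t) *\<^sub>R x + t *\<^sub>R y) \<le> ereal ((1 - t) * a + t * b)"
proof -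
  consider "t = 0" | "t = 1" | "t \<in> {0<..<1}" using assms by force
  then show ?thesis
  proof cases
    case 3
    then have "f ((1 - t) *\<^sub>R x + t *\<^sub>R y) \<le> ereal (1 - t) * f x + ereal t * f y"
      using assms(1) by (auto simp: econvex_def)
    then show ?thesis by (simp add: assms)
  qed (use assms in auto)
qed

lemma convex_eff_dom:
  assumes "proper f" "econvex f"
  shows "convex (eff_dom f)"
  unfolding convex_alt
proof (intro ballI allI impI)
  fix x y and t :: real
  assume xy: "x \<in> eff_dom f" "y \<in> eff_dom f" and t: "0 \<le> t \<and> t \<le> 1"
  obtain a b where "f x = ereal a" "f y = ereal b"
    using xy proper_finite[OF assms(1)] by metis
  from econvex_real[OF assms(2) this, of t] t
  show "(1 - t) *\<^sub>R x + t *\<^sub>R y \<in> eff_dom f" by (auto simp: eff_dom_def)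
qed

text \<open>Fermat's rule for a convex plus a differentiable function. On the segment from
  \<open>p\<close> to \<open>u\<close>, convexity bounds the increase of \<open>\<phi>\<close> by
  \<open>t * (b - a)\<close>, so minimality bounds the difference quotient of \<open>\<psi>\<close>
  below by \<open>a - b\<close>; then \<open>t\<close> tends to 0 from the right.\<close>

lemma neg_gradient_in_subdifferential_of_min:
  fixes \<phi> :: "'a::real_inner \<Rightarrow> ereal" and \<psi> :: "'a \<Rightarrow> real"
  assumes \<phi>: "proper \<phi>" "econvex \<phi>" and d: "GDERIV \<psi> p :> d" and p: "p \<in> eff_dom \<phi>"
    and min: "\<forall>\<^sub>F u in nhds p. \<phi> p + ereal (\<psi> p) \<le> \<phi> u + ereal (\<psi> u)"
  shows "- d \<in> subdifferential \<phi> p"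
  unfolding subdifferential_def
proof (intro CollectI allI)
  fix u
  obtain a where a: "\<phi> p = ereal a" using p proper_finite[OF \<phi>(1)] by blast
  show "\<phi> p + ereal (- d \<bullet> (u - p)) \<le> \<phi> u"
  proof (cases "u \<in> eff_dom \<phi>")
    case False
    then show ?thesis by (simp add: eff_dom_def)
  next
    case True
    then obtain b where b: "\<phi> u = ereal b" using proper_finite[OF \<phi>(1)] by blast
    define c where "c t = p + t *\<^sub>R (u - p)" for t :: real
    have c0: "c 0 = p" by (simp add: c_def)
    have c_der: "(c has_derivative (\<lambda>t. t *\<^sub>R (u - p))) (at 0)"
      unfolding c_def by (auto intro!: derivative_eq_intros)
    have "((\<lambda>t. \<psi> (c t)) has_derivative (\<lambda>t. (t *\<^sub>R (u - p)) \<bullet> d)) (at 0)"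
      using d c0 by (intro has_derivative_compose[OF c_der]) (simp add: gderiv_def)
    then have "DERIV (\<lambda>t. \<psi> (c t)) 0 :> d \<bullet> (u - p)"
      unfolding has_field_derivative_def
      by (rule has_derivative_eq_rhs) (auto simp: fun_eq_iff inner_commute)
    then have "(\<lambda>t. (\<psi> (c t) - \<psi> p) / t) \<midarrow>0\<rightarrow> d \<bullet> (u - p)"
      using c0 by (simp add: DERIV_def)
    then have lim: "((\<lambda>t. (\<psi> (c t) - \<psi> p) / t) \<longlongrightarrow> d \<bullet> (u - p)) (at_right 0)"
      by (rule tendsto_mono[OF at_le[OF subset_UNIV]])
    have "isCont c 0" using c_der by (rule has_derivative_continuous)
    then have "c \<midarrow>0\<rightarrow> p" using c0 by (simp add: isCont_def)
    then have "(c \<longlongrightarrow> p) (at_right 0)"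
      by (rule tendsto_mono[OF at_le[OF subset_UNIV]])
    then have "\<forall>\<^sub>F t in at_right 0. \<phi> p + ereal (\<psi> p) \<le> \<phi> (c t) + ereal (\<psi> (c t))"
      using min by (auto simp: filterlim_iff)
    moreover have "\<forall>\<^sub>F t::real in at_right 0. t \<in> {0<..<1}"
      by (rule eventually_at_right_real) simp
    ultimately have "\<forall>\<^sub>F t in at_right 0. a - b \<le> (\<psi> (c t) - \<psi> p) / t"
    proof eventually_elim
      case (elim t)
      have "c t = (1 - t) *\<^sub>R p + t *\<^sub>R u" by (simp add: c_def algebra_simps)
      then have "\<phi> (c t) \<le> ereal ((1 - t) * a + t * b)"
        using econvex_real[OF \<phi>(2) a b, of t] elim by auto
      with elim a have "a + \<psi> p \<le> (1 - t) * a + t * b + \<psi> (c t)"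
        by (cases "\<phi> (c t)") auto
      then show ?case using elim by (simp add: field_simps)
    qed
    from tendsto_lowerbound[OF lim this] have "a - b \<le> d \<bullet> (u - p)" by simp
    then show ?thesis by (simp add: a b)
  qed
qed

section \<open>Gradients and subgradients at interior points\<close>

lemma has_gradient_unique:
  assumes "has_gradient f x a" "has_gradient f x b"
  shows "a = b"
proof -
  have "(\<lambda>h. h \<bullet> a) = (\<lambda>h. h \<bullet> b)"
    using assms by (auto simp: has_gradient_def gderiv_def intro: has_derivative_unique)
  then have "(a - b) \<bullet> a = (a - b) \<bullet> b" by metis
  then have "(a - b) \<bullet> (a - b) = 0" by (simp add: inner_diff_right)
  then show ?thesis by simp
qed

lemma gradient_eqI: "has_gradient f x d \<Longrightarrow> gradient f x = d"
  unfolding gradient_def by (blast intro: has_gradient_unique)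

lemma real_of_ereal_eff_dom:
  "proper f \<Longrightarrow> x \<in> eff_dom f \<Longrightarrow> ereal (real_of_ereal (f x)) = f x"
  using proper_finite[of f x] by auto

lemma eventually_eff_dom:
  "x \<in> interior (eff_dom f) \<Longrightarrow> \<forall>\<^sub>F u in nhds x. u \<in> eff_dom f"
  unfolding eventually_nhds using interior_subset[of "eff_dom f"]
  by (intro exI[of _ "interior (eff_dom f)"]) auto

text \<open>Subtracting the linear function \<open>s\<close> from \<open>f\<close> leaves a local
  minimum at \<open>x\<close>. Fermat's rule with zero convex part makes \<open>s - d\<close> a
  subgradient of the zero function, and testing it in its own direction shows that it
  vanishes.\<close>

lemma subgradient_eq_gradient:
  assumes f: "proper f" and x: "x \<in> interior (eff_dom f)"
    and d: "has_gradient f x d" and s: "s \<in> subdifferential f x"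
  shows "s = d"
proof -
  let ?\<psi> = "\<lambda>u. real_of_ereal (f u) - s \<bullet> u"
  have xd: "x \<in> eff_dom f" using x interior_subset by blast
  have "GDERIV ?\<psi> x :> d - s"
    using d unfolding has_gradient_def gderiv_def
    by (auto intro!: derivative_eq_intros simp: inner_diff_right inner_commute)
  moreover have "\<forall>\<^sub>F u in nhds x. (0::ereal) + ereal (?\<psi> x) \<le> 0 + ereal (?\<psi> u)"
    using eventually_eff_dom[OF x]
  proof eventually_elim
    case (elim u)
    obtain a b where "f x = ereal a" "f u = ereal b" using xd elim proper_finite[OF f] by metis
    moreover have "f x + ereal (s \<bullet> (u - x)) \<le> f u"
      using s by (simp add: subdifferential_def)
    ultimately show ?case by (simp add: inner_diff_right)
  qed
  ultimately have "- (d - s) \<in> subdifferential (\<lambda>_. 0) x"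
    by (intro neg_gradient_in_subdifferential_of_min[where \<psi> = ?\<psi>])
      (auto simp: proper_def econvex_def eff_dom_def)
  then have "0 + ereal ((s - d) \<bullet> (x + (s - d) - x)) \<le> 0"
    unfolding subdifferential_def by (metis (mono_tags, lifting) mem_Collect_eq minus_diff_eq)
  then have "(s - d) \<bullet> (s - d) \<le> 0" by simp
  then show ?thesis by (metis inner_eq_zero_iff inner_ge_zero order_antisym right_minus_eq)
qed

lemma subdifferential_nonempty_interior:
  fixes f :: "'a::euclidean_space \<Rightarrow> ereal"
  assumes f: "proper f" "econvex f" and z: "z \<in> interior (eff_dom f)"
  obtains s where "s \<in> subdifferential f z"
proof -
  have zd: "z \<in> eff_dom f" using z interior_subset by blast
  then obtain a where a: "f z = ereal a" using proper_finite[OF f(1)] by blast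
  \<comment> \<open>Separate the epigraph from the open ray below the graph at \<open>z\<close>; the hyperplane is not vertical
    because \<open>z\<close> is interior.\<close>
  define S where "S = {(y, r). f y \<le> ereal r}"
  define T where "T = {z} \<times> {..<a}"
  have "convex S"
    unfolding convex_alt
  proof (intro ballI allI impI)
    fix P Q and t :: real
    assume "P \<in> S" "Q \<in> S" and t: "0 \<le> t \<and> t \<le> 1"
    then obtain x r y q where P: "P = (x, r)" "f x \<le> ereal r" and Q: "Q = (y, q)" "f y \<le> ereal q"
      by (auto simp: S_def)
    have "x \<in> eff_dom f" "y \<in> eff_dom f" using P Q by (auto simp: eff_dom_def)
    then obtain b c where bc: "f x = ereal b" "f y = ereal c" using proper_finite[OF f(1)] by metis
    have "f ((1 - t) *\<^sub>R x + t *\<^sub>R y) \<le> ereal ((1 - t) * b + t * c)"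
      using econvex_real[OF f(2) bc] t by auto
    also have "\<dots> \<le> ereal ((1 - t) * r + t * q)"
      using P Q bc t by (auto intro!: add_mono mult_left_mono)
    finally show "(1 - t) *\<^sub>R P + t *\<^sub>R Q \<in> S" by (simp add: S_def P Q)
  qed
  moreover have "convex T" unfolding T_def by (intro convex_Times) auto
  moreover have "(z, a) \<in> S" by (simp add: S_def a)
  moreover have "(z, a - 1) \<in> T" by (simp add: T_def)
  moreover have "S \<inter> T = {}" by (auto simp: S_def T_def a)
  ultimately obtain n b where n: "n \<noteq> 0" "\<forall>P\<in>S. n \<bullet> P \<le> b" "\<forall>P\<in>T. b \<le> n \<bullet> P"
    using separating_hyperplane_sets[of S T] by blast
  obtain v \<alpha> where v: "n = (v, \<alpha>)" by fastforce
  have S: "v \<bullet> y + \<alpha> * r \<le> b" if "f y \<le> ereal r" for y r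
    using n(2) that by (auto simp: S_def v)
  have T: "b \<le> v \<bullet> z + \<alpha> * r" if "r < a" for r
    using n(3) that by (auto simp: T_def v)
  have "v \<bullet> z + \<alpha> * a \<le> b" "b \<le> v \<bullet> z + \<alpha> * (a - 1)"
    using S[of z a] T[of "a - 1"] by (auto simp: a)
  then have "\<alpha> \<le> 0" by (simp add: algebra_simps)
  \<comment> \<open>If the normal were horizontal, moving from \<open>z\<close> in direction
    \<open>v\<close> by half the radius of a ball in the domain would push
    \<open>v \<bullet> y\<close> above \<open>b\<close>.\<close>
  have "\<alpha> \<noteq> 0"
  proof
    assume "\<alpha> = 0"
    then have "v \<noteq> 0" using n(1) v by (auto simp: zero_prod_def)
    obtain e where e: "e > 0" "ball z e \<subseteq> eff_dom f" using z mem_interior by blast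
    define y where "y = z + (e / (2 * norm v)) *\<^sub>R v"
    have "y \<in> eff_dom f" using e \<open>v \<noteq> 0\<close> by (intro subsetD[OF e(2)]) (auto simp: y_def dist_norm)
    then obtain c where "f y = ereal c" using proper_finite[OF f(1)] by blast
    then have "v \<bullet> y \<le> b" using S[of y c] \<open>\<alpha> = 0\<close> by simp
    moreover have "b \<le> v \<bullet> z" using T[of "a - 1"] \<open>\<alpha> = 0\<close> by simp
    ultimately have "(e / (2 * norm v)) * (v \<bullet> v) \<le> 0" by (simp add: y_def inner_add_right)
    moreover have "(e / (2 * norm v)) * (v \<bullet> v) > 0" using e \<open>v \<noteq> 0\<close> by auto
    ultimately show False by simp
  qed
  with \<open>\<alpha> \<le> 0\<close> have \<alpha>: "\<alpha> < 0" by simp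
  \<comment> \<open>The ray \<open>T\<close> omits its endpoint \<open>a\<close>, so the bound there
    is a limit; \<open>e / \<alpha>\<close> is the negative shift that costs exactly
    \<open>e\<close>.\<close>
  have "b \<le> v \<bullet> z + \<alpha> * a"
  proof (rule field_le_epsilon)
    fix e :: real assume "e > 0"
    then have "a + e / \<alpha> < a" using \<alpha> by (simp add: divide_neg_neg divide_pos_neg)
    from T[OF this] have "b \<le> v \<bullet> z + \<alpha> * (a + e / \<alpha>)" .
    also have "\<alpha> * (a + e / \<alpha>) = \<alpha> * a + e" using \<alpha> by (simp add: distrib_left)
    finally show "b \<le> v \<bullet> z + \<alpha> * a + e" by simp
  qed
  \<comment> \<open>Dividing the normal by \<open>- \<alpha>\<close> makes its vertical component
    -1, and the horizontal one is then the slope of a supporting affine function.\<close>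
  have "- (1 / \<alpha>) *\<^sub>R v \<in> subdifferential f z"
    unfolding subdifferential_def
  proof (intro CollectI allI)
    fix y
    show "f z + ereal ((- (1 / \<alpha>) *\<^sub>R v) \<bullet> (y - z)) \<le> f y"
    proof (cases "y \<in> eff_dom f")
      case False
      then show ?thesis by (simp add: eff_dom_def)
    next
      case True
      then obtain c where c: "f y = ereal c" using proper_finite[OF f(1)] by blast
      have "v \<bullet> y + \<alpha> * c \<le> v \<bullet> z + \<alpha> * a" using S[of y c] c \<open>b \<le> v \<bullet> z + \<alpha> * a\<close> by simp
      then show ?thesis using \<alpha> by (simp add: a c inner_diff_right field_simps)
    qed
  qed
  then show ?thesis by (rule that)
qed

section \<open>Lower semicontinuity and attainment\<close>

text \<open>\<open>lsc\<close> uses the punctured limit inferior; the inequality at \<open>y\<close>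
  itself completes the punctured neighbourhood to a full one.\<close>

lemma lsc_open_superlevel:
  assumes "lsc h"
  shows "open {y. c < h y}"
proof (rule Topological_Spaces.openI)
  fix y assume "y \<in> {y. c < h y}"
  moreover have "h y \<le> Liminf (at y) h" using assms by (simp add: lsc_def)
  ultimately have "c < h y" "\<forall>\<^sub>F u in at y. c < h u"
    by (auto intro: less_LiminfD)
  then have "\<forall>\<^sub>F u in nhds y. c < h u" by (simp add: eventually_nhds_conv_at)
  then show "\<exists>T. open T \<and> y \<in> T \<and> T \<subseteq> {y. c < h y}"
    by (auto simp: eventually_nhds)
qed

text \<open>A real \<open>r\<close> strictly between the two sides splits the condition into one on
  \<open>h\<close> and one on \<open>a\<close>, each of them open.\<close>

lemma lsc_minus_continuous_open_superlevel:
  assumes "lsc h" "continuous_on UNIV a"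
  shows "open {y. ereal (a y + c) < h y}"
proof -
  have "{y. ereal (a y + c) < h y} = (\<Union>r. {y. ereal r < h y} \<inter> {y. a y < r - c})"
  proof (intro set_eqI iffI)
    fix y assume "y \<in> {y. ereal (a y + c) < h y}"
    then obtain r where "ereal (a y + c) < ereal r" "ereal r < h y"
      using ereal_dense2[of "ereal (a y + c)" "h y"] by auto
    then show "y \<in> (\<Union>r. {y. ereal r < h y} \<inter> {y. a y < r - c})"
      by (auto intro!: exI[of _ r])
  next
    fix y assume "y \<in> (\<Union>r. {y. ereal r < h y} \<inter> {y. a y < r - c})"
    then obtain r where "ereal r < h y" "a y + c < r" by auto
    then show "y \<in> {y. ereal (a y + c) < h y}"
      using less_trans[of "ereal (a y + c)" "ereal r" "h y"] by simp
  qed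
  moreover have "open {y. a y < r - c}" for r
    using assms(2) by (intro open_Collect_less) auto
  then have "open (\<Union>r. {y. ereal r < h y} \<inter> {y. a y < r - c})"
    by (intro open_UN ballI open_Int lsc_open_superlevel[OF assms(1)])
  ultimately show ?thesis by (rule ssubst)
qed

text \<open>Weierstrass by covering: without a minimizer the open strict superlevel sets at the
  values of \<open>h - a\<close> cover \<open>K\<close>. In a finite subcover, the index with the
  smallest value lies in the set of some other index, whose value would be smaller still.\<close>

lemma lsc_minus_continuous_attains_inf:
  assumes h: "proper h" "lsc h" and a: "continuous_on UNIV a"
    and K: "compact K" "K \<noteq> {}"
  shows "\<exists>x\<in>K. \<forall>y\<in>K. h x - ereal (a x) \<le> h y - ereal (a y)"
proof (rule ccontr)
  \<comment> \<open>Only on \<open>eff_dom h\<close> is this the value of \<open>h - a\<close>, so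
    the cover is indexed by \<open>K \<inter> eff_dom h\<close>.\<close>
  define m where "m y = real_of_ereal (h y) - a y" for y
  let ?U = "\<lambda>y. {u. ereal (a u + m y) < h u}"
  assume "\<not> ?thesis"
  then have lt: "\<exists>y\<in>K. h y - ereal (a y) < h x - ereal (a x)" if "x \<in> K" for x
    using that by (simp add: not_le)
  have cov: "\<exists>y\<in>K \<inter> eff_dom h. x \<in> ?U y" if x: "x \<in> K" for x
  proof -
    obtain y where y: "y \<in> K" "h y - ereal (a y) < h x - ereal (a x)" using lt[OF x] by blast
    then have yd: "y \<in> eff_dom h" by (cases "h y") (auto simp: eff_dom_def)
    then obtain r where r: "h y = ereal r" using proper_finite[OF h(1)] by blast
    then have "x \<in> ?U y" using y by (cases "h x") (auto simp: m_def)
    with y yd show ?thesis by blast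
  qed
  then have cover: "K \<subseteq> (\<Union>y\<in>K \<inter> eff_dom h. ?U y)" by blast
  have op: "open (?U y)" for y by (rule lsc_minus_continuous_open_superlevel[OF h(2) a])
  obtain C where C: "C \<subseteq> K \<inter> eff_dom h" "finite C" "K \<subseteq> (\<Union>y\<in>C. ?U y)"
    by (rule compactE_image[OF K(1) op cover])
  have "C \<noteq> {}" using C K by auto
  then have "Min (m ` C) \<in> m ` C" using C(2) by (intro Min_in) auto
  then obtain y where y: "y \<in> C" "m y = Min (m ` C)" by auto
  obtain u where u: "u \<in> C" "y \<in> ?U u" using y(1) C by blast
  have "y \<in> eff_dom h" using C(1) y(1) by blast
  then have "h y = ereal (real_of_ereal (h y))" by (simp add: real_of_ereal_eff_dom[OF h(1)])
  with u have "ereal (a y + m u) < ereal (real_of_ereal (h y))" by simp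
  then have "m u < m y" by (simp add: m_def)
  moreover have "m y \<le> m u" using u(1) C(2) y(2) by simp
  ultimately show False by simp
qed

section \<open>The conjugate of a strictly convex function\<close>

text \<open>Strict convexity at midpoints makes the subgradient inequality strict away from
  \<open>x\<close>. Compactness of the sphere of radius \<open>\<epsilon>\<close> turns this into a
  uniform gap \<open>\<delta>\<close>, and convexity along rays from \<open>x\<close> spreads it
  outwards with slope \<open>\<delta> / \<epsilon>\<close>.\<close>

lemma strictly_econvex_subgradient_growth:
  fixes h :: "'a::euclidean_space \<Rightarrow> ereal"
  assumes h: "proper h" "lsc h" "strictly_econvex h"
    and v: "v \<in> subdifferential h x" and hx: "h x = ereal c" and \<epsilon>: "\<epsilon> > 0"
  shows "\<exists>\<mu>>0. \<forall>y. \<epsilon> \<le> norm (y - x) \<longrightarrow>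
    ereal (c + v \<bullet> (y - x) + \<mu> * norm (y - x)) \<le> h y"
proof -
  have sub: "ereal (c + v \<bullet> (y - x)) \<le> h y" for y
    using v hx by (auto simp: subdifferential_def)
  have strict: "ereal (c + v \<bullet> (y - x)) < h y" if "y \<noteq> x" for y
  proof (cases "y \<in> eff_dom h")
    case False
    then show ?thesis by (simp add: eff_dom_def)
  next
    case True
    then obtain r where r: "h y = ereal r" using proper_finite[OF h(1)] by blast
    have xd: "x \<in> eff_dom h" using hx by (simp add: eff_dom_def)
    have "h ((1 - 1/2) *\<^sub>R x + (1/2) *\<^sub>R y) < ereal (1 - 1/2) * h x + ereal (1/2) * h y"
      using h(3)[unfolded strictly_econvex_def, rule_format, OF xd True _ that[symmetric], of "1/2"] by simp
    also have "\<dots> = ereal (c / 2 + r / 2)" by (simp add: hx r)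
    finally have "h ((1 - 1/2) *\<^sub>R x + (1/2) *\<^sub>R y) < ereal (c / 2 + r / 2)" .
    moreover have "(1 - t) *\<^sub>R x + t *\<^sub>R y - x = t *\<^sub>R (y - x)" for t :: real
      by (simp add: algebra_simps)
    from this[of "1/2"] have "ereal (c + (1/2) * (v \<bullet> (y - x))) \<le> h ((1 - 1/2) *\<^sub>R x + (1/2) *\<^sub>R y)"
      using sub[of "(1 - 1/2) *\<^sub>R x + (1/2) *\<^sub>R y"] by simp
    ultimately have "ereal (c + (1/2) * (v \<bullet> (y - x))) < ereal (c / 2 + r / 2)"
      by (rule le_less_trans[rotated])
    then show ?thesis by (simp add: r field_simps)
  qed
  have "\<exists>\<delta>>0. \<forall>y\<in>sphere x \<epsilon>. ereal (c + v \<bullet> (y - x) + \<delta>) \<le> h y"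
  proof (cases "sphere x \<epsilon> = {}")
    case True
    then show ?thesis by (auto intro: exI[of _ 1])
  next
    case False
    have "continuous_on UNIV (\<lambda>y. c + v \<bullet> (y - x))" by (intro continuous_intros)
    from lsc_minus_continuous_attains_inf[OF h(1,2) this compact_sphere False]
    obtain y where y: "y \<in> sphere x \<epsilon>"
      and min: "\<And>u. u \<in> sphere x \<epsilon> \<Longrightarrow>
        h y - ereal (c + v \<bullet> (y - x)) \<le> h u - ereal (c + v \<bullet> (u - x))"
      by blast
    have "y \<noteq> x" using y \<epsilon> by auto
    from strict[OF this] have "0 < h y - ereal (c + v \<bullet> (y - x))"
      by (cases "h y") auto
    then obtain \<delta> where \<delta>: "0 < ereal \<delta>" "ereal \<delta> < h y - ereal (c + v \<bullet> (y - x))"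
      using ereal_dense2[of 0] by auto
    have "ereal (c + v \<bullet> (u - x) + \<delta>) \<le> h u" if "u \<in> sphere x \<epsilon>" for u
    proof -
      have "ereal \<delta> \<le> h u - ereal (c + v \<bullet> (u - x))"
        using less_le_trans[OF \<delta>(2) min[OF that]] by (rule less_imp_le)
      then show ?thesis by (cases "h u") auto
    qed
    with \<delta>(1) show ?thesis by auto
  qed
  then obtain \<delta> where \<delta>: "\<delta> > 0" "\<And>y. y \<in> sphere x \<epsilon> \<Longrightarrow> ereal (c + v \<bullet> (y - x) + \<delta>) \<le> h y"
    by blast
  show ?thesis
  proof (intro exI[of _ "\<delta> / \<epsilon>"] conjI allI impI)
    show "\<delta> / \<epsilon> > 0" using \<delta> \<epsilon> by simp
    fix y assume y: "\<epsilon> \<le> norm (y - x)"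
    show "ereal (c + v \<bullet> (y - x) + \<delta> / \<epsilon> * norm (y - x)) \<le> h y"
    proof (cases "y \<in> eff_dom h")
      case False
      then show ?thesis by (simp add: eff_dom_def)
    next
      case True
      then obtain r where r: "h y = ereal r" using proper_finite[OF h(1)] by blast
      \<comment> \<open>Chosen so that \<open>u\<close> below is the point where the segment from
        \<open>x\<close> to \<open>y\<close> crosses the sphere.\<close>
      define t where "t = \<epsilon> / norm (y - x)"
      have pos: "norm (y - x) > 0" using y \<epsilon> by linarith
      have t: "0 < t" "t \<le> 1" using y \<epsilon> pos by (auto simp: t_def)
      define u where "u = (1 - t) *\<^sub>R x + t *\<^sub>R y"
      have ux: "u - x = t *\<^sub>R (y - x)" by (simp add: u_def algebra_simps)
      have "norm (u - x) = \<epsilon>" using \<epsilon> pos by (simp add: ux t_def)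
      then have "u \<in> sphere x \<epsilon>" by (simp add: dist_norm norm_minus_commute)
      from \<delta>(2)[OF this] have "ereal (c + t * (v \<bullet> (y - x)) + \<delta>) \<le> h u" by (simp add: ux)
      also have "\<dots> \<le> ereal ((1 - t) * c + t * r)"
        unfolding u_def
        using econvex_real[OF strictly_econvex_imp_econvex[OF h(1,3)] hx r] t by simp
      finally have "\<delta> \<le> t * (r - c - v \<bullet> (y - x))" by (simp add: algebra_simps)
      then have "\<delta> / t \<le> r - c - v \<bullet> (y - x)" using t by (simp add: field_simps)
      moreover have "\<delta> / t = \<delta> / \<epsilon> * norm (y - x)" by (simp add: t_def)
      ultimately show ?thesis by (simp add: r)
    qed
  qed
qed

text \<open>Strict convexity of \<open>h\<close> dualizes to smoothness of its conjugate. The point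
  \<open>x\<close> itself gives an affine lower bound for the conjugate near \<open>v\<close>; an
  upper bound exceeding it by at most \<open>e * norm d\<close> for small \<open>d\<close> is
  Frechet differentiability with gradient \<open>x\<close>.\<close>

lemma conjugate_differentiable_at_subgradient:
  fixes h :: "'a::euclidean_space \<Rightarrow> ereal"
  assumes h: "proper h" "lsc h" "strictly_econvex h" and v: "v \<in> subdifferential h x"
  shows "v \<in> interior (eff_dom (conjugate h))" and "has_gradient (conjugate h) v x"
proof -
  obtain c where c: "h x = ereal c"
    using subdifferential_imp_eff_dom[OF h(1) v] proper_finite[OF h(1)] by blast
  have sub: "ereal (c + v \<bullet> (y - x)) \<le> h y" for y
    using v c by (auto simp: subdifferential_def)
  have lower: "ereal ((v + d) \<bullet> x - c) \<le> conjugate h (v + d)" for d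
    unfolding conjugate_def by (rule SUP_upper2[of x]) (auto simp: c)
  \<comment> \<open>In the supremum defining the conjugate at \<open>v + d\<close>, linear growth rules out the points farther
    than \<open>e\<close> from \<open>x\<close>.\<close>
  have upper: "\<exists>\<delta>>0. \<forall>d. norm d \<le> \<delta> \<longrightarrow>
      conjugate h (v + d) \<le> ereal ((v + d) \<bullet> x - c + e * norm d)" if e: "e > 0" for e
  proof -
    obtain \<mu> where \<mu>: "\<mu> > 0"
      "\<And>y. norm (y - x) \<ge> e \<Longrightarrow> ereal (c + v \<bullet> (y - x) + \<mu> * norm (y - x)) \<le> h y"
      using strictly_econvex_subgradient_growth[OF h v c e] by blast
    have "conjugate h (v + d) \<le> ereal ((v + d) \<bullet> x - c + e * norm d)" if d: "norm d \<le> \<mu>" for d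
      unfolding conjugate_def
    proof (rule SUP_least)
      fix y
      have cs: "d \<bullet> (y - x) \<le> norm d * norm (y - x)" by (rule norm_cauchy_schwarz)
      have "ereal (c + v \<bullet> (y - x) + d \<bullet> (y - x) - e * norm d) \<le> h y"
      proof (cases "norm (y - x) \<ge> e")
        case True
        have "norm d * norm (y - x) \<le> \<mu> * norm (y - x)" using d by (simp add: mult_right_mono)
        moreover have "0 \<le> e * norm d" using e by simp
        ultimately have "c + v \<bullet> (y - x) + d \<bullet> (y - x) - e * norm d
            \<le> c + v \<bullet> (y - x) + \<mu> * norm (y - x)" using cs by linarith
        then show ?thesis using \<mu>(2)[OF True] by (meson ereal_less_eq(3) order_trans)
      next
        case False
        then have "norm d * norm (y - x) \<le> norm d * e" by (intro mult_left_mono) auto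
        then have "c + v \<bullet> (y - x) + d \<bullet> (y - x) - e * norm d \<le> c + v \<bullet> (y - x)"
          using cs by (simp add: mult.commute)
        then show ?thesis using sub[of y] by (meson ereal_less_eq(3) order_trans)
      qed
      then show "ereal ((v + d) \<bullet> y) - h y \<le> ereal ((v + d) \<bullet> x - c + e * norm d)"
        by (cases "h y") (auto simp: inner_diff_right inner_add_left)
    qed
    with \<mu>(1) show ?thesis by blast
  qed
  \<comment> \<open>The instance \<open>e = 1\<close> serves to make the conjugate finite on a ball
    around \<open>v\<close>.\<close>
  obtain \<delta> where \<delta>: "\<delta> > 0" "\<And>d. norm d \<le> \<delta> \<Longrightarrow>
      conjugate h (v + d) \<le> ereal ((v + d) \<bullet> x - c + 1 * norm d)"
    using upper[of 1] by auto
  have "ball v \<delta> \<subseteq> eff_dom (conjugate h)"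
  proof
    fix u assume "u \<in> ball v \<delta>"
    then have "norm (u - v) \<le> \<delta>" by (simp add: dist_norm norm_minus_commute)
    from \<delta>(2)[OF this] show "u \<in> eff_dom (conjugate h)"
      by (auto simp: eff_dom_def intro: le_less_trans)
  qed
  then show "v \<in> interior (eff_dom (conjugate h))" using \<delta>(1) mem_interior by blast
  let ?H = "\<lambda>u. real_of_ereal (conjugate h u)"
  have val: "conjugate h v = ereal (v \<bullet> x - c)"
    using lower[of 0] \<delta>(2)[of 0] \<delta>(1) by (simp add: antisym)
  have "(?H has_derivative (\<lambda>d. d \<bullet> x)) (at v)"
    unfolding has_derivative_at_alt
  proof (intro conjI allI impI)
    show "bounded_linear (\<lambda>d. d \<bullet> x)" by (rule bounded_linear_inner_left)
    fix e :: real assume "e > 0"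
    from upper[OF this] obtain \<eta> where \<eta>: "\<eta> > 0" "\<And>d. norm d \<le> \<eta> \<Longrightarrow>
      conjugate h (v + d) \<le> ereal ((v + d) \<bullet> x - c + e * norm d)" by blast
    have "norm (?H u - ?H v - (u - v) \<bullet> x) \<le> e * norm (u - v)" if "norm (u - v) < \<eta>" for u
    proof -
      have "conjugate h u \<le> ereal (u \<bullet> x - c + e * norm (u - v))"
        using \<eta>(2)[of "u - v"] that by simp
      moreover have "ereal (u \<bullet> x - c) \<le> conjugate h u" using lower[of "u - v"] by simp
      ultimately show ?thesis
        by (cases "conjugate h u") (auto simp: val inner_diff_left)
    qed
    then show "\<exists>d>0. \<forall>u. norm (u - v) < d \<longrightarrow>
        norm (?H u - ?H v - (u - v) \<bullet> x) \<le> e * norm (u - v)"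
      using \<eta>(1) by blast
  qed
  then show "has_gradient (conjugate h) v x" by (simp add: has_gradient_def gderiv_def)
qed

text \<open>A minimizer of \<open>h\<close> minus the linear function \<open>v\<close> has
  \<open>v\<close> as a subgradient. It exists because coercivity confines the search to a ball,
  where lower semicontinuity gives attainment.\<close>

lemma interior_conjugate_subgradient:
  fixes h :: "'a::euclidean_space \<Rightarrow> ereal"
  assumes h: "proper h" "lsc h" and v: "v \<in> interior (eff_dom (conjugate h))"
  obtains x where "v \<in> subdifferential h x"
proof -
  obtain e where e: "e > 0" "cball v e \<subseteq> eff_dom (conjugate h)"
    using v mem_interior_cball by blast
  have fin: "\<exists>M. conjugate h u \<le> ereal M" if "u \<in> cball v e" for u
    using e(2) that by (cases "conjugate h u") (auto simp: eff_dom_def)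
  \<comment> \<open>Finiteness of the conjugate at finitely many points around \<open>v\<close> makes \<open>h - v\<close> coercive.\<close>
  define V where "V = (\<lambda>b. v + e *\<^sub>R b) ` Basis \<union> (\<lambda>b. v - e *\<^sub>R b) ` (Basis :: 'a set)"
  have "finite V" by (simp add: V_def)
  have V: "V \<subseteq> cball v e" using e(1) by (auto simp: V_def dist_norm)
  obtain m where m: "\<And>u. u \<in> V \<Longrightarrow> conjugate h u \<le> ereal (m u)"
    using fin V by (metis subsetD)
  define M where "M = Max (m ` V)"
  have M: "conjugate h u \<le> ereal M" if "u \<in> V" for u
  proof -
    have "m u \<le> M" unfolding M_def using that \<open>finite V\<close> by simp
    then show ?thesis using m[OF that] by (meson ereal_less_eq(3) order_trans)
  qed
  have Vh: "ereal (u \<bullet> y - M) \<le> h y" if "u \<in> V" for u y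
  proof -
    have "ereal (u \<bullet> y) - h y \<le> conjugate h u" unfolding conjugate_def by (rule SUP_upper) simp
    also have "\<dots> \<le> ereal M" using M[OF that] .
    finally show ?thesis by (cases "h y") auto
  qed
  have coercive: "ereal (v \<bullet> y + e * \<bar>y \<bullet> b\<bar> - M) \<le> h y" if b: "b \<in> Basis" for b y
  proof (cases "y \<bullet> b \<ge> 0")
    case True
    moreover have "(v + e *\<^sub>R b) \<bullet> y = v \<bullet> y + e * (y \<bullet> b)"
      by (simp add: inner_add_left inner_commute[of b])
    moreover have "v + e *\<^sub>R b \<in> V" using b by (auto simp: V_def)
    ultimately show ?thesis using Vh[of "v + e *\<^sub>R b" y] by simp
  next
    case False
    moreover have "(v - e *\<^sub>R b) \<bullet> y = v \<bullet> y - e * (y \<bullet> b)"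
      by (simp add: inner_diff_left inner_commute[of b])
    moreover have "v - e *\<^sub>R b \<in> V" using b by (auto simp: V_def)
    ultimately show ?thesis using Vh[of "v - e *\<^sub>R b" y] by simp
  qed
  obtain x0 where x0: "x0 \<in> eff_dom h" using h(1) by (auto simp: proper_def eff_dom_def)
  then obtain c where c: "h x0 = ereal c" using proper_finite[OF h(1)] by blast
  \<comment> \<open>A coordinate larger than \<open>R\<close> in absolute value already forces a
    value at least that at \<open>x0\<close>. Coordinates all within \<open>R\<close> bound the norm
    by \<open>DIM('a) * R\<close>; the other entry of the maximum keeps \<open>x0\<close> in the
    ball.\<close>
  define R where "R = (c - v \<bullet> x0 + M) / e"
  define B where "B = max (norm x0) (real DIM('a) * R)"
  have out: "ereal (c - v \<bullet> x0) \<le> h y - ereal (v \<bullet> y)" if y: "y \<notin> cball 0 B" for y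
  proof -
    have "\<exists>b\<in>Basis. \<bar>y \<bullet> b\<bar> > R"
    proof (rule ccontr)
      assume "\<not> ?thesis"
      then have "(\<Sum>b\<in>Basis. \<bar>y \<bullet> b\<bar>) \<le> (\<Sum>b\<in>(Basis::'a set). R)"
        by (intro sum_mono) (auto simp: not_less)
      then have "norm y \<le> real DIM('a) * R" using norm_le_l1[of y] by simp
      with y show False by (simp add: B_def)
    qed
    then obtain b where b: "b \<in> Basis" "\<bar>y \<bullet> b\<bar> > R" by blast
    then have "c - v \<bullet> x0 + M \<le> e * \<bar>y \<bullet> b\<bar>" using e(1) by (simp add: R_def field_simps)
    then show ?thesis using coercive[OF b(1), of y] by (cases "h y") auto
  qed
  have x0B: "x0 \<in> cball 0 B" by (simp add: B_def)
  have "continuous_on UNIV (\<lambda>y. v \<bullet> y)"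
    by (intro linear_continuous_on bounded_linear_inner_right)
  from lsc_minus_continuous_attains_inf[OF h this compact_cball, of 0 B] x0B
  have "\<exists>x\<in>cball 0 B. \<forall>y\<in>cball 0 B. h x - ereal (v \<bullet> x) \<le> h y - ereal (v \<bullet> y)"
    by (metis empty_iff)
  then obtain x where x: "x \<in> cball 0 B"
    "\<And>y. y \<in> cball 0 B \<Longrightarrow> h x - ereal (v \<bullet> x) \<le> h y - ereal (v \<bullet> y)"
    by blast
  have le: "h x - ereal (v \<bullet> x) \<le> ereal (c - v \<bullet> x0)" using x(2)[OF x0B] by (simp add: c)
  then have "x \<in> eff_dom h" by (auto simp: eff_dom_def)
  then obtain r where r: "h x = ereal r" using proper_finite[OF h(1)] by blast
  have min: "h x - ereal (v \<bullet> x) \<le> h y - ereal (v \<bullet> y)" for y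
    using x(2) out le order_trans by blast
  have "h x + ereal (v \<bullet> (y - x)) \<le> h y" for y
    using min[of y] r by (cases "h y") (auto simp: inner_diff_right)
  then have "v \<in> subdifferential h x" by (simp add: subdifferential_def)
  then show ?thesis by (rule that)
qed

section \<open>Legendre functions\<close>

lemma legendre_proper: "legendre h \<Longrightarrow> proper h"
  by (simp add: legendre_def)

lemma legendre_econvex: "legendre h \<Longrightarrow> econvex h"
  by (simp add: legendre_def strictly_econvex_imp_econvex)

lemma legendre_has_gradient:
  assumes "legendre h" "x \<in> interior (eff_dom h)"
  shows "has_gradient h x (gradient h x)"
proof -
  have "\<exists>d. has_gradient h x d"
    using assms unfolding legendre_def essentially_smooth_def by blast
  then obtain d where "has_gradient h x d" by blast
  moreover from this have "gradient h x = d" by (rule gradient_eqI)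
  ultimately show ?thesis by simp
qed

text \<open>Separation provides some subgradient at an interior point, and differentiability
  identifies it with the gradient.\<close>

lemma legendre_gradient_in_subdifferential:
  fixes h :: "'a::euclidean_space \<Rightarrow> ereal"
  assumes "legendre h" "x \<in> interior (eff_dom h)"
  shows "gradient h x \<in> subdifferential h x"
proof -
  obtain s where s: "s \<in> subdifferential h x"
    using subdifferential_nonempty_interior[OF legendre_proper legendre_econvex assms(2)] assms(1)
    by metis
  have "s = gradient h x"
    using assms(1) by (intro subgradient_eq_gradient[OF _ assms(2) _ s])
      (auto intro: legendre_proper legendre_has_gradient assms)
  with s show ?thesis by simp
qed

lemma legendre_gradient_conjugate_gradient:
  fixes h :: "'a::euclidean_space \<Rightarrow> ereal"
  assumes h: "legendre h" and x: "x \<in> interior (eff_dom h)"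
  shows "gradient h x \<in> interior (eff_dom (conjugate h))"
    and "gradient (conjugate h) (gradient h x) = x"
proof -
  have "proper h" "lsc h" "strictly_econvex h" using h by (auto simp: legendre_def)
  note diff = conjugate_differentiable_at_subgradient[OF this
      legendre_gradient_in_subdifferential[OF h x]]
  show "gradient h x \<in> interior (eff_dom (conjugate h))" by (rule diff(1))
  show "gradient (conjugate h) (gradient h x) = x" by (rule gradient_eqI[OF diff(2)])
qed

text \<open>The subgradient relation determines \<open>gradient (conjugate h) v\<close> as the point
  where \<open>v\<close> is a subgradient of \<open>h\<close>. Hypothesis \<open>x\<close> is
  supplied for the mirror points by \<open>bprs\<close>, which places them in the interior of the
  domain.\<close>

lemma legendre_gradient_gradient_conjugate:
  fixes h :: "'a::euclidean_space \<Rightarrow> ereal"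
  assumes h: "legendre h" and v: "v \<in> interior (eff_dom (conjugate h))"
    and x: "gradient (conjugate h) v \<in> interior (eff_dom h)"
  shows "gradient h (gradient (conjugate h) v) = v"
proof -
  have p: "proper h" "lsc h" "strictly_econvex h" using h by (auto simp: legendre_def)
  obtain y where y: "v \<in> subdifferential h y"
    using interior_conjugate_subgradient[OF p(1,2) v] by metis
  have "gradient (conjugate h) v = y"
    by (rule gradient_eqI[OF conjugate_differentiable_at_subgradient(2)[OF p y]])
  with subgradient_eq_gradient[OF p(1) x legendre_has_gradient[OF h x]] y
  show ?thesis by simp
qed

section \<open>Bregman distances and the optimality condition of the proximal step\<close>

lemma bregman_eff_dom:
  assumes "proper h" "x \<in> eff_dom h" "y \<in> eff_dom h"
  shows "bregman h x y =
    ereal (real_of_ereal (h x) - real_of_ereal (h y) - gradient h y \<bullet> (x - y))"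
  using proper_finite[OF assms(1,2)] proper_finite[OF assms(1,3)] by (auto simp: bregman_def)

lemma bregman_nonneg:
  fixes h :: "'a::euclidean_space \<Rightarrow> ereal"
  assumes h: "legendre h" and "x \<in> eff_dom h" "y \<in> interior (eff_dom h)"
  shows "0 \<le> real_of_ereal (bregman h x y)"
proof -
  note h' = legendre_proper[OF h]
  have y: "y \<in> eff_dom h" using assms(3) interior_subset by blast
  have "h y + ereal (gradient h y \<bullet> (x - y)) \<le> h x"
    using legendre_gradient_in_subdifferential[OF h assms(3)] by (simp add: subdifferential_def)
  then show ?thesis
    using proper_finite[OF h' assms(2)] proper_finite[OF h' y] by (auto simp: bregman_def)
qed

text \<open>Fermat's rule with the scaled Bregman distance as differentiable part, whose gradient at
  \<open>p\<close> is the difference of the two gradients of \<open>h\<close> divided by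
  \<open>c\<close>.\<close>

lemma bregman_prox_subgradient:
  fixes h :: "'a::euclidean_space \<Rightarrow> ereal"
  assumes h: "legendre h" and \<phi>: "proper \<phi>" "econvex \<phi>" and c: "c > 0"
    and y: "y \<in> interior (eff_dom h)" "y \<in> eff_dom \<phi>"
    and prox: "bregman_prox h \<phi> c y p" and p: "p \<in> interior (eff_dom h)"
  shows "(1 / c) *\<^sub>R (gradient h y - gradient h p) \<in> subdifferential \<phi> p"
proof -
  note h' = legendre_proper[OF h]
  let ?H = "\<lambda>u. real_of_ereal (h u)"
  define \<psi> where "\<psi> u = (1 / c) * (?H u - ?H y - gradient h y \<bullet> (u - y))" for u
  have dom: "y \<in> eff_dom h" "p \<in> eff_dom h" using y p interior_subset by blast+
  have \<psi>: "ereal (1 / c) * bregman h u y = ereal (\<psi> u)" if "u \<in> eff_dom h" for u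
    using that dom by (simp add: bregman_eff_dom[OF h'] \<psi>_def)
  have min: "\<phi> p + ereal (\<psi> p) \<le> \<phi> u + ereal (\<psi> u)" if "u \<in> eff_dom h" for u
    using prox \<psi>[OF that] \<psi>[OF dom(2)] unfolding bregman_prox_def is_arg_min_def
    by (metis not_le)
  \<comment> \<open>The competitor \<open>y\<close> has a finite objective value, so the minimal
    value is finite too.\<close>
  have "p \<in> eff_dom \<phi>"
    using min[OF dom(1)] y(2) by (cases "\<phi> p"; cases "\<phi> y") (auto simp: eff_dom_def)
  moreover have "GDERIV \<psi> p :> (1 / c) *\<^sub>R (gradient h p - gradient h y)"
    using legendre_has_gradient[OF h p] c unfolding \<psi>_def has_gradient_def gderiv_def
    by (auto intro!: derivative_eq_intros
        simp: fun_eq_iff inner_diff_right inner_diff_left inner_commute)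
  moreover have "\<forall>\<^sub>F u in nhds p. \<phi> p + ereal (\<psi> p) \<le> \<phi> u + ereal (\<psi> u)"
    using eventually_eff_dom[OF p] min by (rule eventually_mono)
  ultimately have "- ((1 / c) *\<^sub>R (gradient h p - gradient h y)) \<in> subdifferential \<phi> p"
    using \<phi> by (intro neg_gradient_in_subdifferential_of_min)
  then show ?thesis by (simp add: algebra_simps)
qed

section \<open>Convergence of the splitting method\<close>

text \<open>A subgradient at \<open>z\<close> bounds the excess of \<open>f z\<close> over
  \<open>f y\<close> by Cauchy-Schwarz. This later carries upper bounds from the iterates to their
  midpoint.\<close>

lemma le_add_subgradient_bound:
  fixes f :: "'a::euclidean_space \<Rightarrow> ereal"
  assumes f: "proper f" "econvex f" and K: "\<forall>s\<in>subdifferential f z. norm s \<le> K"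
    and z: "z \<in> interior (eff_dom f)" and y: "y \<in> eff_dom f"
  shows "real_of_ereal (f z) \<le> real_of_ereal (f y) + K * norm (z - y)"
proof -
  obtain s where s: "s \<in> subdifferential f z"
    using subdifferential_nonempty_interior[OF f z] by metis
  have zd: "z \<in> eff_dom f" using z interior_subset by blast
  have "f z + ereal (s \<bullet> (y - z)) \<le> f y" using s by (simp add: subdifferential_def)
  then have "real_of_ereal (f z) + s \<bullet> (y - z) \<le> real_of_ereal (f y)"
    using proper_finite[OF f(1) zd] proper_finite[OF f(1) y] by auto
  moreover have "- (s \<bullet> (y - z)) \<le> norm s * norm (z - y)"
    using norm_cauchy_schwarz[of s "z - y"] by (simp add: inner_diff_right)
  moreover have "norm s * norm (z - y) \<le> K * norm (z - y)"
    using K s by (simp add: mult_right_mono)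
  ultimately show ?thesis by linarith
qed

lemma subdifferential_real:
  assumes "proper f" "s \<in> subdifferential f x" "y \<in> eff_dom f"
  shows "real_of_ereal (f x) + s \<bullet> (y - x) \<le> real_of_ereal (f y)"
proof -
  have "f x + ereal (s \<bullet> (y - x)) \<le> f y" using assms(2) by (simp add: subdifferential_def)
  then show ?thesis
    using proper_finite[OF assms(1) subdifferential_imp_eff_dom[OF assms(1,2)]]
      proper_finite[OF assms(1,3)] by auto
qed

lemma half_step_estimate:
  fixes h f g :: "'a::euclidean_space \<Rightarrow> ereal"
  assumes h: "legendre h"
    and L: "L-lipschitz_on (interior (eff_dom (conjugate h))) (gradient (conjugate h))"
    and ab: "a \<in> interior (eff_dom h)" "b \<in> interior (eff_dom h)"
    and f: "proper f" "s \<in> subdifferential f a" "norm s \<le> K"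
    and g: "proper g" "t \<in> subdifferential g b" "norm t \<le> K"
    and \<gamma>: "\<gamma> > 0"
    and step: "gradient h b = gradient h a - \<gamma> *\<^sub>R (s + t)"
    and u: "u \<in> eff_dom h" "u \<in> eff_dom f" "u \<in> eff_dom g"
  shows "norm (b - a) \<le> 2 * L * K * \<gamma>"
    and "\<gamma> * (real_of_ereal (f a) + real_of_ereal (g b)
            - real_of_ereal (f u) - real_of_ereal (g u))
      \<le> real_of_ereal (bregman h u a) - real_of_ereal (bregman h u b) + 2 * L * K\<^sup>2 * \<gamma>\<^sup>2"
proof -
  note h' = legendre_proper[OF h]
  have L0: "0 \<le> L" using L by (simp add: lipschitz_on_def)
  have K0: "0 \<le> K" using f(3) norm_ge_zero order_trans by blast
  \<comment> \<open>The gradient of the conjugate maps \<open>gradient h a\<close> and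
    \<open>gradient h b\<close> back to \<open>a\<close> and \<open>b\<close>, so its Lipschitz
    bound controls the primal step by the dual one.\<close>
  have "norm (b - a) \<le> L * norm (gradient h b - gradient h a)"
    using lipschitz_onD[OF L, of "gradient h b" "gradient h a"]
      legendre_gradient_conjugate_gradient[OF h] ab by (simp add: dist_norm)
  also have "norm (gradient h b - gradient h a) = \<gamma> * norm (s + t)"
    using \<gamma> by (simp add: step)
  also have "L * (\<gamma> * norm (s + t)) \<le> L * (\<gamma> * (K + K))"
    using L0 \<gamma> f(3) g(3) by (intro mult_left_mono norm_triangle_le add_mono) auto
  finally show ba: "norm (b - a) \<le> 2 * L * K * \<gamma>" by (simp add: algebra_simps)
  have dom: "a \<in> eff_dom h" "b \<in> eff_dom h" using ab interior_subset by blast+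
  let ?D = "\<lambda>x y. real_of_ereal (bregman h x y)"
  \<comment> \<open>The three-point identity.\<close>
  have "?D u a - ?D u b = ?D b a + (gradient h b - gradient h a) \<bullet> (u - b)"
    using dom u by (simp add: bregman_eff_dom[OF h'] inner_diff_left inner_diff_right)
  moreover have "0 \<le> ?D b a" by (rule bregman_nonneg[OF h dom(2) ab(1)])
  \<comment> \<open>Since \<open>s\<close> belongs to \<open>a\<close> and not to \<open>b\<close>,
    its product is recentred at \<open>a\<close>; the leftover \<open>s \<bullet> (a - b)\<close> is
    of order \<open>\<gamma>\<close> by the first estimate.\<close>
  moreover have "(gradient h b - gradient h a) \<bullet> (u - b)
      = - \<gamma> * (s \<bullet> (u - a)) - \<gamma> * (t \<bullet> (u - b)) - \<gamma> * (s \<bullet> (a - b))"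
    by (simp add: step inner_diff_right inner_add_left algebra_simps)
  moreover have "\<gamma> * (real_of_ereal (f a) + s \<bullet> (u - a)) \<le> \<gamma> * real_of_ereal (f u)"
    using subdifferential_real[OF f(1,2) u(2)] \<gamma> by simp
  moreover have "\<gamma> * (real_of_ereal (g b) + t \<bullet> (u - b)) \<le> \<gamma> * real_of_ereal (g u)"
    using subdifferential_real[OF g(1,2) u(3)] \<gamma> by simp
  moreover have "s \<bullet> (a - b) \<le> K * (2 * L * K * \<gamma>)"
  proof -
    have "s \<bullet> (a - b) \<le> norm s * norm (b - a)"
      using norm_cauchy_schwarz[of s "a - b"] by (simp add: norm_minus_commute)
    also have "\<dots> \<le> K * (2 * L * K * \<gamma>)" using f(3) ba K0 by (intro mult_mono) auto
    finally show ?thesis .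
  qed
  then have "\<gamma> * (s \<bullet> (a - b)) \<le> 2 * L * K\<^sup>2 * \<gamma>\<^sup>2"
    using mult_left_mono[of _ _ \<gamma>] \<gamma> by (fastforce simp: power2_eq_square algebra_simps)
  ultimately show "\<gamma> * (real_of_ereal (f a) + real_of_ereal (g b)
            - real_of_ereal (f u) - real_of_ereal (g u))
      \<le> ?D u a - ?D u b + 2 * L * K\<^sup>2 * \<gamma>\<^sup>2"
    by (simp add: algebra_simps)
qed

text \<open>The harmonic sum minus the logarithm decreases and starts at 1.\<close>

lemma sum_inverse_le_ln:
  assumes "N \<ge> 1"
  shows "(\<Sum>k=1..N. 1 / real k) \<le> 1 + ln (real N)"
proof -
  obtain n where n: "N = Suc n" using assms by (cases N) auto
  have "harm (Suc n) - ln (real (Suc n)) \<le> (harm (Suc 0) - ln (real (Suc 0)) :: real)"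
    using decseqD[OF decseq_harm_diff_ln, of 0 n] by simp
  then show ?thesis by (simp add: n harm_def inverse_eq_divide)
qed

text \<open>Each of the \<open>N\<close> summands is at least the last one.\<close>

lemma sqrt_le_sum_inverse_sqrt: "sqrt (real N) \<le> (\<Sum>k=1..N. 1 / sqrt (real k))"
proof (cases "N = 0")
  case False
  have "sqrt (real N) = (\<Sum>k=1..N. 1 / sqrt (real N))" using False by (simp add: real_div_sqrt)
  also have "\<dots> \<le> (\<Sum>k=1..N. 1 / sqrt (real k))"
    using False by (intro sum_mono divide_left_mono) auto
  finally show ?thesis .
qed simp

text \<open>Summation of the step inequalities: \<open>D\<close> telescopes, the squared step sizes
  sum to at most \<open>1 + ln N\<close>, and the step sizes to at least \<open>sqrt N\<close>.
  Nonnegativity of \<open>m\<close> allows the last replacement.\<close>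

lemma min_gap_le_log_over_sqrt:
  fixes e D :: "nat \<Rightarrow> real"
  assumes D: "\<And>k. k \<ge> 1 \<Longrightarrow> 0 \<le> D k" and C: "C \<ge> 0"
    and step: "\<And>k. k \<ge> 1 \<Longrightarrow> 1 / sqrt (real k) * e k \<le> D k - D (Suc k) + C * (1 / real k)"
    and m: "\<And>k. k \<in> {1..N} \<Longrightarrow> m \<le> e k" "0 \<le> m" and N: "N \<ge> 3"
  shows "m \<le> (D 1 + 2 * C) * (ln (real N) / sqrt (real N))"
proof -
  have tel: "(\<Sum>k=1..n. D k - D (Suc k)) = D 1 - D (Suc n)" for n by (induction n) auto
  \<comment> \<open>From 3 on the logarithm is at least 1, so that the constant
    \<open>D 1 + C\<close> can be absorbed into a multiple of it.\<close>
  have "exp 1 \<le> real N" using exp_le N by linarith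
  then have ln1: "1 \<le> ln (real N)" using N by (subst ln_ge_iff) auto
  have "sqrt (real N) * m \<le> (\<Sum>k=1..N. 1 / sqrt (real k)) * m"
    using m(2) by (intro mult_right_mono sqrt_le_sum_inverse_sqrt)
  also have "\<dots> = (\<Sum>k=1..N. 1 / sqrt (real k) * m)" by (rule sum_distrib_right)
  also have "\<dots> \<le> (\<Sum>k=1..N. D k - D (Suc k) + C * (1 / real k))"
  proof (rule sum_mono)
    fix k assume k: "k \<in> {1..N}"
    have "1 / sqrt (real k) * m \<le> 1 / sqrt (real k) * e k"
      using m(1)[OF k] by (intro mult_left_mono) auto
    then show "1 / sqrt (real k) * m \<le> D k - D (Suc k) + C * (1 / real k)"
      using step[of k] k by auto
  qed
  also have "\<dots> = (\<Sum>k=1..N. D k - D (Suc k)) + C * (\<Sum>k=1..N. 1 / real k)"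
    by (simp only: sum.distrib sum_distrib_left)
  also note tel
  also have "C * (\<Sum>k=1..N. 1 / real k) \<le> C * (1 + ln (real N))"
    using C N by (intro mult_left_mono sum_inverse_le_ln) auto
  also have "D 1 - D (Suc N) + C * (1 + ln (real N)) \<le> (D 1 + 2 * C) * ln (real N)"
    using D[of "Suc N"] mult_left_mono[OF ln1, of "D 1 + C"] D[of 1] C by (simp add: algebra_simps)
  finally show ?thesis using N by (simp add: field_simps)
qed

lemma log_over_sqrt_rate:
  fixes m :: "nat \<Rightarrow> real"
  assumes "\<And>N. N \<ge> 1 \<Longrightarrow> 0 \<le> m N"
    and "\<And>N. N \<ge> 3 \<Longrightarrow> m N \<le> A * (ln (real N) / sqrt (real N))"
  shows "m \<longlonglongrightarrow> 0" and "m \<in> O(\<lambda>N. ln (real N) / sqrt (real N))"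
proof -
  have "(\<lambda>N. ln (real N) / sqrt (real N)) \<longlonglongrightarrow> 0" by real_asymp
  then have "(\<lambda>N. A * (ln (real N) / sqrt (real N))) \<longlonglongrightarrow> 0" by (rule tendsto_mult_right_zero)
  then show "m \<longlonglongrightarrow> 0"
    by (rule tendsto_sandwich[rotated 3, OF _ _ _ tendsto_const])
      (use assms in \<open>auto simp: eventually_at_top_linorder\<close>)
  have "\<forall>\<^sub>F N in at_top. norm (m N) \<le> A * norm (ln (real N) / sqrt (real N))"
    using eventually_ge_at_top[of 3]
  proof eventually_elim
    case (elim N)
    then have "0 \<le> ln (real N) / sqrt (real N)" by simp
    then show ?case using assms elim by simp
  qed
  then show "m \<in> O(\<lambda>N. ln (real N) / sqrt (real N))" by (rule bigoI)
qed

text \<open>Eliminates the mirror point \<open>a'\<close>: its dual image is that of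
  \<open>a\<close> shifted by \<open>- c\<close> times \<open>s\<close>, and the optimality
  condition of the proximal step supplies \<open>t\<close>.\<close>

lemma peaceman_rachford_half_step:
  fixes h :: "'a::euclidean_space \<Rightarrow> ereal"
  assumes h: "legendre h" and \<phi>: "proper \<phi>" "econvex \<phi>" and c: "c > 0"
    and dom: "interior (eff_dom h) \<subseteq> eff_dom \<phi>"
    and mirror: "mirror_step h c a s a'" "a' \<in> interior (eff_dom h)"
    and prox: "bregman_prox h \<phi> c a' b" "b \<in> interior (eff_dom h)"
  shows "\<exists>t. t \<in> subdifferential \<phi> b \<and> gradient h b = gradient h a - c *\<^sub>R (s + t)"
proof (intro exI conjI)
  let ?t = "(1 / c) *\<^sub>R (gradient h a' - gradient h b)"
  show "?t \<in> subdifferential \<phi> b"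
    using dom mirror(2) by (intro bregman_prox_subgradient[OF h \<phi> c mirror(2) _ prox]) blast
  have "gradient h a' = gradient h a - c *\<^sub>R s"
    using mirror legendre_gradient_gradient_conjugate[OF h] by (simp add: mirror_step_def)
  then show "gradient h b = gradient h a - c *\<^sub>R (s + ?t)"
    using c by (simp add: scaleR_add_right)
qed

text \<open>Two half steps, the second with \<open>f\<close> and \<open>g\<close> exchanged, added
  and moved to the midpoint. At \<open>b\<close>, \<open>t\<close> comes from the proximal step
  whereas \<open>t'\<close> is the chosen subgradient of the next mirror step, so the two may
  differ. The constant 10 is 2 from each half step and 6 from the moves.\<close>

lemma full_step_estimate:
  fixes h f g :: "'a::euclidean_space \<Rightarrow> ereal"
  assumes h: "legendre h"
    and L: "L-lipschitz_on (interior (eff_dom (conjugate h))) (gradient (conjugate h))"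
    and f: "proper f" "econvex f" "\<And>y. \<forall>s\<in>subdifferential f y. norm s \<le> K"
    and g: "proper g" "econvex g" "\<And>y. \<forall>s\<in>subdifferential g y. norm s \<le> K"
    and dom: "interior (eff_dom h) \<subseteq> interior (eff_dom f)"
      "interior (eff_dom h) \<subseteq> interior (eff_dom g)"
    and abd: "a \<in> interior (eff_dom h)" "b \<in> interior (eff_dom h)" "d \<in> interior (eff_dom h)"
    and \<gamma>: "\<gamma> > 0"
    and st1: "s \<in> subdifferential f a" "t \<in> subdifferential g b"
      "gradient h b = gradient h a - \<gamma> *\<^sub>R (s + t)"
    and st2: "t' \<in> subdifferential g b" "s' \<in> subdifferential f d"
      "gradient h d = gradient h b - \<gamma> *\<^sub>R (t' + s')"
    and u: "u \<in> eff_dom h" "u \<in> eff_dom f" "u \<in> eff_dom g"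
    and z: "z = (1 / 2) *\<^sub>R (b + d)"
  shows "z \<in> interior (eff_dom h)"
    and "2 * (\<gamma> * (real_of_ereal (f z) + real_of_ereal (g z)
            - real_of_ereal (f u) - real_of_ereal (g u)))
      \<le> real_of_ereal (bregman h u a) - real_of_ereal (bregman h u d) + 10 * L * K\<^sup>2 * \<gamma>\<^sup>2"
proof -
  have "convex (interior (eff_dom h))"
    by (intro convex_interior convex_eff_dom legendre_proper legendre_econvex h)
  from convexD[OF this abd(2,3), of "1/2" "1/2"] show zi: "z \<in> interior (eff_dom h)"
    by (simp add: z scaleR_add_right)
  note half1 = half_step_estimate[OF h L abd(1,2) f(1) st1(1) bspec[OF f(3) st1(1)]
      g(1) st1(2) bspec[OF g(3) st1(2)] \<gamma> st1(3) u]
  note half2 = half_step_estimate[OF h L abd(2,3) g(1) st2(1) bspec[OF g(3) st2(1)]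
      f(1) st2(2) bspec[OF f(3) st2(2)] \<gamma> st2(3) u(1,3,2)]
  have K0: "0 \<le> K" using bspec[OF f(3) st1(1)] norm_ge_zero order_trans by blast
  have zb: "norm (z - b) \<le> L * K * \<gamma>"
  proof -
    have "z - b = (1 / 2) *\<^sub>R (d - b)" by (simp add: z algebra_simps flip: scaleR_left.add)
    then show ?thesis using half2(1) by simp
  qed
  have zd: "norm (z - d) \<le> L * K * \<gamma>"
  proof -
    have "z - d = (1 / 2) *\<^sub>R (b - d)" by (simp add: z algebra_simps flip: scaleR_left.add)
    then show ?thesis using half2(1) by (simp add: norm_minus_commute)
  qed
  \<comment> \<open>One unit from \<open>z\<close> to \<open>b\<close> and two from \<open>b\<close>
    to \<open>a\<close>.\<close>
  have za: "norm (z - a) \<le> 3 * (L * K * \<gamma>)"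
    using norm_triangle_ineq[of "z - b" "b - a"] zb half1(1) by simp
  have mem: "z \<in> interior (eff_dom f)" "z \<in> interior (eff_dom g)"
    "a \<in> eff_dom f" "b \<in> eff_dom g" "d \<in> eff_dom f"
    using zi abd dom interior_subset by blast+
  define X where "X = L * K\<^sup>2 * \<gamma>"
  have KX: "K * norm v \<le> n * X" if "norm v \<le> n * (L * K * \<gamma>)" for v :: 'a and n
    using mult_left_mono[OF that K0] by (simp add: X_def power2_eq_square algebra_simps)
  let ?f = "\<lambda>y. real_of_ereal (f y)" and ?g = "\<lambda>y. real_of_ereal (g y)"
  have "?f z \<le> ?f a + 3 * X"
    using le_add_subgradient_bound[OF f mem(1) mem(3)] KX[OF za] by simp
  moreover have "?f z \<le> ?f d + 1 * X"
    using le_add_subgradient_bound[OF f mem(1) mem(5)] KX[of "z - d" 1] zd by simp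
  moreover have "?g z \<le> ?g b + 1 * X"
    using le_add_subgradient_bound[OF g mem(2) mem(4)] KX[of "z - b" 1] zb by simp
  \<comment> \<open>The two copies of \<open>f z\<close> are compared with \<open>f a\<close> and
    \<open>f d\<close>, and both copies of \<open>g z\<close> with \<open>g b\<close>:
    \<open>3 + 1 + 1 + 1 = 6\<close> units \<open>X\<close>.\<close>
  ultimately have "2 * (?f z + ?g z - ?f u - ?g u)
      \<le> (?f a + ?g b - ?f u - ?g u) + (?g b + ?f d - ?g u - ?f u) + 6 * X" by simp
  from mult_left_mono[OF this, of \<gamma>] \<gamma>
  have "2 * (\<gamma> * (?f z + ?g z - ?f u - ?g u))
      \<le> \<gamma> * (?f a + ?g b - ?f u - ?g u) + \<gamma> * (?g b + ?f d - ?g u - ?f u) + 6 * (\<gamma> * X)"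
    by (simp add: algebra_simps)
  moreover have "\<gamma> * X = L * K\<^sup>2 * \<gamma>\<^sup>2" by (simp add: X_def power2_eq_square)
  ultimately show "2 * (\<gamma> * (?f z + ?g z - ?f u - ?g u))
      \<le> real_of_ereal (bregman h u a) - real_of_ereal (bregman h u d) + 10 * L * K\<^sup>2 * \<gamma>\<^sup>2"
    using half1(2) half2(2) by simp
qed

theorem theoremA2:
  fixes h f g :: "real ^ 'n \<Rightarrow> ereal"
    and \<sigma> G :: real
    and w xbar x wbar p q z :: "nat \<Rightarrow> real ^ 'n"
    and xstar :: "real ^ 'n"
    and gap :: "nat \<Rightarrow> ereal"
  assumes h: "legendre h"
    and f: "proper f" "lsc f" "econvex f"
    and g: "proper g" "lsc g" "econvex g"
    and im: "gradient (conjugate h) ` interior (eff_dom (conjugate h)) \<subseteq> eff_dom f \<inter> eff_dom g"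
    and G: "G > 0"
      "\<And>y s. s \<in> subdifferential f y \<Longrightarrow> infnorm s \<le> G"
      "\<And>y s. s \<in> subdifferential g y \<Longrightarrow> infnorm s \<le> G"
    and strong: "\<sigma> > 0" "strongly_convex_on_simplex \<sigma> h"
    and lipschitz: "\<exists>L. L-lipschitz_on (interior (eff_dom (conjugate h))) (gradient (conjugate h))"
    and minimizer: "is_arg_min (\<lambda>y. f y + g y) (\<lambda>_. True) xstar" "xstar \<in> eff_dom h"
    and iterates: "bprs h f g (\<lambda>k. 1 / sqrt (real k)) w xbar x wbar p q"
    and z: "\<And>k. k \<ge> 1 \<Longrightarrow> z (k + 1) = (1 / 2) *\<^sub>R (x (k + 1) + w (k + 1))"
    and gap: "\<And>N. N \<ge> 1 \<Longrightarrow>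
      gap N = Min ((\<lambda>k. f (z (k + 1)) + g (z (k + 1))) ` {1..N}) - (f xstar + g xstar)"
  shows "(\<forall>N\<ge>1. \<bar>gap N\<bar> \<noteq> \<infinity>)
    \<and> gap \<longlonglongrightarrow> 0
    \<and> (\<lambda>N. real_of_ereal (gap N)) \<in> O(\<lambda>N. ln (real N) / sqrt (real N))"
proof -
  obtain L where L: "L-lipschitz_on (interior (eff_dom (conjugate h))) (gradient (conjugate h))"
    using lipschitz by blast
  then have L0: "0 \<le> L" by (simp add: lipschitz_on_def)
  \<comment> \<open>Converts the sup-norm bound on subgradients into a Euclidean one.\<close>
  define K where "K = sqrt DIM(real ^ 'n) * G"
  have K: "norm s \<le> K" if "infnorm s \<le> G" for s :: "real ^ 'n"
  proof -
    have "norm s \<le> sqrt DIM(real ^ 'n) * infnorm s" by (rule norm_le_infnorm)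
    also have "\<dots> \<le> K" unfolding K_def using that by (intro mult_left_mono) auto
    finally show ?thesis .
  qed
  then have fK: "\<forall>s\<in>subdifferential f y. norm s \<le> K"
    and gK: "\<forall>s\<in>subdifferential g y. norm s \<le> K" for y
    using G(2,3) by blast+
  let ?I = "interior (eff_dom h)"
  \<comment> \<open>Each interior point is the image of its own gradient under the gradient of the
    conjugate, so assumption \<open>im\<close> applies to it.\<close>
  have "?I \<subseteq> eff_dom f \<inter> eff_dom g"
  proof
    fix y assume "y \<in> ?I"
    from legendre_gradient_conjugate_gradient[OF h this] im
    show "y \<in> eff_dom f \<inter> eff_dom g" by (metis image_eqI subsetD)
  qed
  then have sub: "?I \<subseteq> eff_dom f" "?I \<subseteq> eff_dom g" by auto
  then have dom: "?I \<subseteq> interior (eff_dom f)" "?I \<subseteq> interior (eff_dom g)"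
    by (auto intro: interior_maximal[OF _ open_interior, THEN subsetD])
  have w1: "w 1 \<in> ?I" using iterates by (simp add: bprs_def)
  have it: "p k \<in> subdifferential f (w k)"
      "mirror_step h (1 / sqrt (real k)) (w k) (p k) (xbar k)" "xbar k \<in> ?I"
      "bregman_prox h g (1 / sqrt (real k)) (xbar k) (x (k + 1))" "x (k + 1) \<in> ?I"
      "q k \<in> subdifferential g (x (k + 1))"
      "mirror_step h (1 / sqrt (real k)) (x (k + 1)) (q k) (wbar (k + 1))" "wbar (k + 1) \<in> ?I"
      "bregman_prox h f (1 / sqrt (real k)) (wbar (k + 1)) (w (k + 1))" "w (k + 1) \<in> ?I"
    if "k \<ge> 1" for k
    using iterates that unfolding bprs_def by blast+
  have w: "w k \<in> ?I" if "k \<ge> 1" for k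
  proof (cases "k = 1")
    case False
    with that show ?thesis using it(10)[of "k - 1"] by simp
  qed (simp add: w1[simplified])
  have opt: "f xstar + g xstar \<le> f y + g y" for y
    using minimizer(1) by (simp add: is_arg_min_def not_less)
  \<comment> \<open>A finite objective at the starting point forces a finite optimal value, and with
    it \<open>xstar\<close> into both domains.\<close>
  have "f (w 1) < \<infinity>" "g (w 1) < \<infinity>" using w1 sub by (auto simp: eff_dom_def)
  with opt[of "w 1"] have "f xstar + g xstar < \<infinity>"
    by (cases "f (w 1)"; cases "g (w 1)") (auto intro: le_less_trans)
  then have xs: "xstar \<in> eff_dom f" "xstar \<in> eff_dom g"
    using f(1) g(1) by (cases "f xstar"; cases "g xstar"; auto simp: eff_dom_def proper_def)+
  define val where "val y = real_of_ereal (f y) + real_of_ereal (g y)" for y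
  have val: "f y + g y = ereal (val y)" if "y \<in> eff_dom f" "y \<in> eff_dom g" for y
    using real_of_ereal_eff_dom[OF f(1) that(1)] real_of_ereal_eff_dom[OF g(1) that(2)]
    by (simp add: val_def flip: plus_ereal.simps(1))
  define e where "e k = val (z (k + 1)) - val xstar" for k
  \<comment> \<open>Halved because a full step bounds twice the gap; for the same reason 10 becomes
    5 below.\<close>
  define D where "D k = real_of_ereal (bregman h xstar (w k)) / 2" for k
  have main: "z (k + 1) \<in> ?I \<and>
      1 / sqrt (real k) * e k \<le> D k - D (Suc k) + 5 * L * K\<^sup>2 * (1 / real k)" if k: "k \<ge> 1" for k
  proof -
    note itk = it[OF k]
    have \<gamma>: "1 / sqrt (real k) > 0" using k by simp
    obtain t where t: "t \<in> subdifferential g (x (k + 1))"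
      "gradient h (x (k + 1)) = gradient h (w k) - (1 / sqrt (real k)) *\<^sub>R (p k + t)"
      using peaceman_rachford_half_step[OF h g(1,3) \<gamma> sub(2) itk(2-5)] by blast
    obtain s where s: "s \<in> subdifferential f (w (k + 1))"
      "gradient h (w (k + 1)) = gradient h (x (k + 1)) - (1 / sqrt (real k)) *\<^sub>R (q k + s)"
      using peaceman_rachford_half_step[OF h f(1,3) \<gamma> sub(1) itk(7-10)] by blast
    note full = full_step_estimate[OF h L f(1,3) fK g(1,3) gK dom w[OF k] itk(5,10) \<gamma>
        itk(1) t itk(6) s minimizer(2) xs z[OF k]]
    have sq: "(1 / sqrt (real k))\<^sup>2 = 1 / real k" by (simp add: power_divide)
    have e: "real_of_ereal (f (z (k + 1))) + real_of_ereal (g (z (k + 1)))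
        - real_of_ereal (f xstar) - real_of_ereal (g xstar) = e k"
      by (simp add: e_def val_def)
    have "2 * (1 / sqrt (real k) * e k) \<le> 2 * D k - 2 * D (Suc k) + 10 * L * K\<^sup>2 * (1 / real k)"
      using full(2) unfolding e sq by (simp add: D_def)
    then have "1 / sqrt (real k) * e k \<le> D k - D (Suc k) + 5 * L * K\<^sup>2 * (1 / real k)"
      by linarith
    with full(1) show ?thesis by simp
  qed
  define m where "m N = real_of_ereal (gap N)" for N
  \<comment> \<open>All objective values involved are finite, and the monotone map from gaps to
    objective values commutes with \<open>Min\<close>, so the extended-real minimum reduces to a
    real one.\<close>
  have gap_eq: "gap N = ereal (Min (e ` {1..N}))" if N: "N \<ge> 1" for N
  proof -
    have "f (z (k + 1)) + g (z (k + 1)) = ereal (e k + val xstar)" if "k \<in> {1..N}" for k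
      using main[of k] that sub by (simp add: e_def) (blast intro: val)
    then have "(\<lambda>k. f (z (k + 1)) + g (z (k + 1))) ` {1..N}
        = (\<lambda>r. ereal (r + val xstar)) ` e ` {1..N}"
      by (simp add: image_image)
    moreover have "Min ((\<lambda>r. ereal (r + val xstar)) ` e ` {1..N})
        = ereal (Min (e ` {1..N}) + val xstar)"
      using N by (intro mono_Min_commute[symmetric] monoI) auto
    ultimately show ?thesis using gap[OF N] val[OF xs] by simp
  qed
  have m_le: "m N \<le> e k" if "k \<in> {1..N}" for N k
    using gap_eq[of N] that by (simp add: m_def)
  have m_nonneg: "0 \<le> m N" if N: "N \<ge> 1" for N
  proof -
    have "0 \<le> e k" if "k \<in> {1..N}" for k
    proof -
      have "z (k + 1) \<in> eff_dom f" "z (k + 1) \<in> eff_dom g" using main[of k] that sub by auto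
      then show ?thesis using opt[of "z (k + 1)"] by (simp add: val xs e_def)
    qed
    then show ?thesis using N by (simp add: m_def gap_eq)
  qed
  have rate: "m N \<le> (D 1 + 2 * (5 * L * K\<^sup>2)) * (ln (real N) / sqrt (real N))" if "N \<ge> 3" for N
  proof (rule min_gap_le_log_over_sqrt[where e = e and D = D])
    show "0 \<le> D k" if "k \<ge> 1" for k
      using bregman_nonneg[OF h minimizer(2) w[OF that]] by (simp add: D_def)
    show "0 \<le> m N" using m_nonneg that by simp
  qed (use main m_le L0 that in auto)
  note asym = log_over_sqrt_rate[of m, OF m_nonneg rate]
  have gap_m: "gap N = ereal (m N)" if "N \<ge> 1" for N
    using gap_eq[OF that] by (simp add: m_def)
  have "(\<lambda>N. ereal (m N)) \<longlonglongrightarrow> ereal 0" using asym(1) by (simp only: lim_ereal)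
  \<comment> \<open>\<open>gap 0\<close> is unconstrained and may be infinite, so the two sequences
    are identified only from index 1 on.\<close>
  moreover have "\<forall>\<^sub>F N in sequentially. ereal (m N) = gap N"
    using eventually_ge_at_top[of 1] by eventually_elim (simp add: gap_m)
  ultimately have "gap \<longlonglongrightarrow> ereal 0" by (rule Lim_transform_eventually)
  then have "gap \<longlonglongrightarrow> 0" by (simp add: zero_ereal_def)
  moreover have "\<forall>N\<ge>1. \<bar>gap N\<bar> \<noteq> \<infinity>" by (simp add: gap_m)
  ultimately show ?thesis using asym(2) by (simp add: m_def[abs_def])
qed

end
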